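(* Let $1<p\le q<\infty$, $b_0,b_1,b_2,c_0,c_1,c_2\in\mathbb{R}$ with $c_1-c_2=b_1-b_2\ge0$, let $k\ge1$ be an integer, and let $$K(x,y)=x^{b_1}y^{c_1}\sum_{m=0}^\infty a_m(xy)^{km},\qquad x,y>0,\quad a_m\in\mathbb{C},$$ where $\sum_{m=0}^\infty|a_m|<\infty$, the series converges for every $x,y>0$, and $|K(x,y)|\lesssim x^{b_2}y^{c_2}$ for $xy>1$. Let $$Ff(y)=y^{c_0}\int_0^\infty x^{b_0}f(x)K(x,y)\,dx,\qquad y>0.$$ Let $n\ge1$ be an integer and let $\beta,\gamma\in\mathbb{R}$ satisfy $$\beta=\gamma+c_0-b_0+c_1-b_1+\frac1q-\frac1{p'},\qquad \frac1q+c_0+c_1<\beta<\frac1q+c_0+c_1+nk,$$ and $\beta\ne\frac1q+c_0+c_1+jk$ for $j=1,\dots,n-1$. Then there is a constant $C$ such that $$\Vert y^{-\beta}Ff\Vert_q\le C\Vert x^\gamma f\Vert_p$$ for every measurable $f:(0,\infty)\to\mathbb{C}$ such that $$\int_0^\infty x^{b_0+b_1+\ell k}f(x)\,dx=0,\qquad \ell=0,\dots,n-1.$$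
   Context: Notation: $p'=p/(p-1)$; $\Vert g\Vert_p=\big(\int_0^\infty|g(x)|^p\,dx\big)^{1/p}$ (possibly $+\infty$). $A\lesssim B$ means $A\le cB$ with $c>0$ independent of $x,y$. The moment conditions are understood with Lebesgue integrals (the functions $x^{b_0+b_1+\ell k}f(x)$ are integrable on $(0,\infty)$); the integral defining $Ff(y)$ is then absolutely convergent for every $y>0$. *)

theory Defs
  imports "HOL-Analysis.Analysis"
begin

text \<open>
  Functions on \<open>(0,\<infinity>)\<close> are represented by functions on \<open>real\<close> whose values outside
  \<open>{0<..}\<close> are never used; "measurable" and all integrals refer to Lebesgue measure on \<open>{0<..}\<close>.
\<close>

definition conj_exp :: "real \<Rightarrow> real" where
  "conj_exp p = p / (p - 1)"

text \<open>
  The norm is extended-valued. As \<open>powr\<close> is not available on \<^typ>\<open>ennreal\<close>, the \<open>p\<close>-th root is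
  taken on reals, with the value \<open>\<infinity>\<close> treated separately.
\<close>

definition Lp_norm :: "real \<Rightarrow> (real \<Rightarrow> complex) \<Rightarrow> ennreal" where
  "Lp_norm p g =
     (let I = (\<integral>\<^sup>+ x. ennreal (norm (g x) powr p) \<partial>lebesgue_on {0<..})
      in if I = \<infinity> then \<infinity> else ennreal (enn2real I powr (1 / p)))"

definition series_kernel ::
  "real \<Rightarrow> real \<Rightarrow> nat \<Rightarrow> (nat \<Rightarrow> complex) \<Rightarrow> real \<Rightarrow> real \<Rightarrow> complex" where
  "series_kernel b1 c1 k a x y =
     of_real (x powr b1 * y powr c1) * (\<Sum>m. a m * of_real (x * y) ^ (k * m))"

definition kernel_transform ::
  "real \<Rightarrow> real \<Rightarrow> (real \<Rightarrow> real \<Rightarrow> complex) \<Rightarrow> (real \<Rightarrow> complex) \<Rightarrow> real \<Rightarrow> complex" where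
  "kernel_transform b0 c0 K f y =
     of_real (y powr c0) *
     (\<integral>x. of_real (x powr b0) * f x * K x y \<partial>lebesgue_on {0<..})"

end

theory Submission
  imports Defs
begin

text \<open>
  Write \<open>K(x,y) = x\<^bsup>b1\<^esup> y\<^bsup>c1\<^esup> S(xy)\<close>, where the profile \<open>S(t) = \<Sum>m. a\<^sub>m t\<^bsup>km\<^esup>\<close> depends on one
  variable only, and let \<open>\<delta> = \<beta> - 1/q - c0 - c1\<close>, so that \<open>0 < \<delta> < nk\<close> and \<open>\<delta>\<close> is not a
  multiple of \<open>k\<close>. The profile is bounded: up to \<open>1\<close> by \<open>\<Sum>m. |a\<^sub>m|\<close>, and beyond \<open>1\<close> by the growth
  hypothesis, since \<open>b2 \<le> b1\<close>. Choose \<open>j < n\<close> with \<open>jk < \<delta> < (j+1)k\<close>. The moment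
  conditions of order at most \<open>j\<close> ensure that subtracting from \<open>S\<close> its Taylor polynomial of
  degree \<open>jk\<close> does not change \<open>Ff\<close> (\<open>kernel_transform_eq_remainder_integral\<close>). The remainder is
  \<open>O(t\<^bsup>(j+1)k\<^esup>)\<close> at zero, where it is the tail of the series, and \<open>O(t\<^bsup>jk\<^esup>)\<close> at infinity,
  because the profile and its Taylor polynomial are (\<open>norm_profile_remainder_le\<close>). Since \<open>\<delta>\<close> lies
  strictly between the two exponents, the remainder is at most a constant times \<open>t\<^sup>\<delta> W(t)\<close> with
  \<open>W(t) = min (t\<^sup>\<epsilon>) (t\<^bsup>-\<epsilon>\<^esup>)\<close> and some \<open>\<epsilon> > 0\<close>.

  With \<open>g = x\<^sup>\<gamma> f\<close> and \<open>h = y\<^bsup>-\<beta>\<^esup> Ff\<close>, the relation between \<open>\<beta>\<close> and \<open>\<gamma>\<close> is exactly the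
  homogeneity that turns this bound into
  \<open>|h(y)| \<le> D y\<^bsup>-1/q\<^esup> \<integral> x\<^bsup>1/p - 1\<^esup> W(xy) |g(x)| dx\<close>. In terms of the Haar measure \<open>dx/x\<close> this is,
  after the inversion \<open>x \<mapsto> 1/x\<close>, a convolution on the multiplicative group with the kernel \<open>W\<close>, which is integrable and bounded, and
  the assertion is an instance of Young's inequality, \<open>Lp_norm_le_of_decay_kernel_bound\<close>.
  Put \<open>\<tau>(y) = y\<^bsup>1/q\<^esup> |h(y)| / D\<close>. For \<open>p \<le> q\<close> and a kernel bounded by \<open>1\<close>, one
  application of Jensen's inequality gives both the \<open>L\<^sup>p\<close> bound and the uniform bound, and \<open>\<tau>\<^sup>q = (\<tau>\<^sup>p)\<^bsup>q/p - 1\<^esup> \<tau>\<^sup>p\<close> interpolates between them.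
\<close>

section \<open>An integrable kernel on the multiplicative group\<close>

definition decay_kernel :: "real \<Rightarrow> real \<Rightarrow> real" where
  "decay_kernel \<epsilon> t = min (t powr \<epsilon>) (t powr (- \<epsilon>))"

lemma decay_kernel_nonneg: "0 \<le> decay_kernel \<epsilon> t"
  by (simp add: decay_kernel_def)

lemma decay_kernel_le_1:
  assumes "0 < t" "0 \<le> \<epsilon>" shows "decay_kernel \<epsilon> t \<le> 1"
proof (cases "t \<le> 1")
  case True
  then show ?thesis using assms powr_le1[of \<epsilon> t] by (simp add: decay_kernel_def)
next
  case False
  then have "t powr (-\<epsilon>) \<le> t powr 0" using assms by (intro powr_mono) auto
  then show ?thesis using assms by (simp add: decay_kernel_def)
qed

lemma borel_measurable_decay_kernel [measurable]: "decay_kernel \<epsilon> \<in> borel_measurable borel"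
  unfolding decay_kernel_def [abs_def] by measurable

lemma borel_measurable_ident_lebesgue_on [measurable]:
  "(\<lambda>x::real. x) \<in> borel_measurable (lebesgue_on S)"
  using id_borel_measurable_lebesgue_on[of S] by (simp add: id_def)

lemma nn_integral_lebesgue_on_eq_lborel:
  fixes g :: "real \<Rightarrow> ennreal"
  assumes "S \<in> sets borel" "g \<in> borel_measurable borel"
  shows "(\<integral>\<^sup>+x. g x \<partial>lebesgue_on S) = (\<integral>\<^sup>+x. g x * indicator S x \<partial>lborel)"
  using assms by (simp add: nn_integral_restrict_space nn_integral_completion)

lemma sigma_finite_lebesgue_on:
  fixes S :: "real set"
  assumes "S \<in> sets lebesgue"
  shows "sigma_finite_measure (lebesgue_on S)"
proof -
  from lborel.sigma_finite_countable obtain C :: "real set set" where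
    C: "countable C" "C \<subseteq> sets lborel" "\<Union>C = space lborel" "\<forall>a\<in>C. emeasure lborel a \<noteq> \<infinity>"
    by metis
  have "sigma_finite_measure (completion lborel :: real measure)"
    using C by unfold_locales
      (intro exI[of _ C], auto intro!: sets_completionI_sets)
  then show ?thesis
    using assms by (intro sigma_finite_measure_restrict_space) auto
qed

text \<open>
  The invariance of \<open>dx/x\<close> under \<open>x \<mapsto> x y\<close> makes the bound independent of \<open>y\<close>: splitting at
  \<open>x = 1/y\<close>, where the minimum changes branch, each half contributes \<open>1/\<epsilon>\<close>.
\<close>

lemma nn_integral_decay_kernel_le:
  assumes "0 < \<epsilon>" "0 < y"
  shows "(\<integral>\<^sup>+x. ennreal (decay_kernel \<epsilon> (x * y) / x) \<partial>lebesgue_on {0<..}) \<le> ennreal (2 / \<epsilon>)"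
proof -
  have low: "(\<integral>\<^sup>+x. ennreal (x powr (\<epsilon> - 1)) * indicator {0..1/y} x \<partial>lborel)
      = ennreal ((1/y) powr \<epsilon> / \<epsilon>)"
    using has_integral_powr_from_0[of "\<epsilon> - 1" "1/y"] assms
    by (intro nn_integral_has_integral_lebesgue') auto
  have high: "(\<integral>\<^sup>+x. ennreal (x powr (- \<epsilon> - 1)) * indicator {1/y..} x \<partial>lborel)
      = ennreal ((1/y) powr (- \<epsilon>) / \<epsilon>)"
    using has_integral_powr_to_inf[of "- \<epsilon> - 1" "1/y"] assms
    by (intro nn_integral_has_integral_lebesgue') auto
  have ptw: "ennreal (decay_kernel \<epsilon> (x * y) / x) * indicator {0<..} x
      \<le> ennreal (y powr \<epsilon>) * (ennreal (x powr (\<epsilon> - 1)) * indicator {0..1/y} x)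
        + ennreal (y powr (-\<epsilon>)) * (ennreal (x powr (- \<epsilon> - 1)) * indicator {1/y..} x)" for x
  proof (cases "0 < x")
    case x: True
    show ?thesis
    proof (cases "x \<le> 1/y")
      case True
      have "decay_kernel \<epsilon> (x * y) / x \<le> (x * y) powr \<epsilon> / x"
        using x by (intro divide_right_mono) (auto simp: decay_kernel_def)
      also have "\<dots> = y powr \<epsilon> * x powr (\<epsilon> - 1)"
        using x assms by (simp add: powr_mult powr_diff)
      finally have "ennreal (decay_kernel \<epsilon> (x * y) / x) \<le> ennreal (y powr \<epsilon>) * ennreal (x powr (\<epsilon> - 1))"
        by (simp add: ennreal_leI flip: ennreal_mult)
      then show ?thesis using True x by (simp add: indicator_def add_increasing2)
    next
      case False
      have "decay_kernel \<epsilon> (x * y) / x \<le> (x * y) powr (-\<epsilon>) / x"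
        using x by (intro divide_right_mono) (auto simp: decay_kernel_def)
      also have "\<dots> = y powr (-\<epsilon>) * x powr (- \<epsilon> - 1)"
        using x assms by (simp add: powr_mult powr_diff)
      finally have "ennreal (decay_kernel \<epsilon> (x * y) / x) \<le> ennreal (y powr (-\<epsilon>)) * ennreal (x powr (-\<epsilon> - 1))"
        by (simp add: ennreal_leI flip: ennreal_mult)
      then show ?thesis using False x by (simp add: indicator_def)
    qed
  qed simp
  have "(\<integral>\<^sup>+x. ennreal (decay_kernel \<epsilon> (x * y) / x) \<partial>lebesgue_on {0<..})
      = (\<integral>\<^sup>+x. ennreal (decay_kernel \<epsilon> (x * y) / x) * indicator {0<..} x \<partial>lborel)"
    by (intro nn_integral_lebesgue_on_eq_lborel) auto
  also have "\<dots> \<le> (\<integral>\<^sup>+x. ennreal (y powr \<epsilon>) * (ennreal (x powr (\<epsilon> - 1)) * indicator {0..1/y} x)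
        + ennreal (y powr (-\<epsilon>)) * (ennreal (x powr (- \<epsilon> - 1)) * indicator {1/y..} x) \<partial>lborel)"
    by (intro nn_integral_mono ptw)
  also have "\<dots> = ennreal (y powr \<epsilon>) * ennreal ((1/y) powr \<epsilon> / \<epsilon>)
        + ennreal (y powr (-\<epsilon>)) * ennreal ((1/y) powr (- \<epsilon>) / \<epsilon>)"
    by (simp add: nn_integral_add nn_integral_cmult low high)
  also have "\<dots> = ennreal (y powr \<epsilon> * ((1/y) powr \<epsilon> / \<epsilon>) + y powr (-\<epsilon>) * ((1/y) powr (- \<epsilon>) / \<epsilon>))"
    using assms by (simp del: times_divide_eq_right flip: ennreal_mult ennreal_plus)
  also have "\<dots> = ennreal (2 / \<epsilon>)"
    using assms by (simp add: powr_divide powr_minus field_simps)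
  finally show ?thesis .
qed

section \<open>A Young inequality for dominated operators\<close>

text \<open>
  The graph of the convex function \<open>u \<mapsto> u\<^sup>p\<close> lies above its tangent at \<open>s\<close>; this is Young's inequality
  for the product of \<open>u\<close> and \<open>s\<^bsup>p - 1\<^esup>\<close>.
\<close>

lemma powr_tangent_le:
  fixes p s u :: real
  assumes "1 < p" "0 < s" "0 \<le> u"
  shows "p * s powr (p - 1) * u \<le> u powr p + (p - 1) * s powr p"
proof -
  have "u * s powr (p - 1) \<le> u powr p / p + (s powr (p - 1)) powr (p / (p - 1)) / (p / (p - 1))"
    using assms by (intro Youngs_inequality) (auto simp: field_simps)
  also have "(s powr (p - 1)) powr (p / (p - 1)) = s powr p"
    using assms by (simp add: powr_powr)
  finally have "p * (u * s powr (p - 1)) \<le> p * (u powr p / p + s powr p / (p / (p - 1)))"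
    using assms by (intro mult_left_mono) auto
  also have "\<dots> = u powr p + (p - 1) * s powr p"
    using assms by (simp add: field_simps)
  finally show ?thesis by (simp add: algebra_simps)
qed

text \<open>
  Integrate the tangent inequality at the mean value \<open>s = \<tau>/A\<close> against the weight. This
  point does not involve the integral of \<open>w u\<^sup>p\<close>, which may vanish, unlike the normalising
  constant in the usual proof of Hoelder's inequality.
\<close>

lemma weighted_jensen_powr:
  fixes w u :: "'a \<Rightarrow> real" and p A \<tau> :: real
  assumes "1 < p" "0 < A" "0 \<le> \<tau>"
    and [measurable]: "w \<in> borel_measurable M" "u \<in> borel_measurable M"
    and w: "\<And>x. x \<in> space M \<Longrightarrow> 0 \<le> w x" and u: "\<And>x. x \<in> space M \<Longrightarrow> 0 \<le> u x"
    and mass: "(\<integral>\<^sup>+x. ennreal (w x) \<partial>M) \<le> ennreal A"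
    and mean: "ennreal \<tau> \<le> (\<integral>\<^sup>+x. ennreal (w x * u x) \<partial>M)"
  shows "ennreal (\<tau> powr p) \<le> ennreal (A powr (p - 1)) * (\<integral>\<^sup>+x. ennreal (w x * u x powr p) \<partial>M)"
    (is "_ \<le> _ * ?P")
proof (cases "\<tau> = 0 \<or> ?P = \<infinity>")
  case True
  then show ?thesis using assms by (auto simp: ennreal_mult_top)
next
  case False
  then have \<tau>: "0 < \<tau>" using assms by simp
  obtain P where P: "?P = ennreal P" "0 \<le> P"
    using False by (cases ?P) auto
  define s where "s = \<tau> / A"
  have s: "0 < s" using \<tau> assms by (simp add: s_def)
  define c where "c = p * s powr (p - 1)"
  have c: "0 \<le> c" using assms by (simp add: c_def)
  have "ennreal (c * \<tau>) = ennreal c * ennreal \<tau>"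
    using c \<tau> by (simp add: ennreal_mult)
  also have "\<dots> \<le> ennreal c * (\<integral>\<^sup>+x. ennreal (w x * u x) \<partial>M)"
    by (intro mult_left_mono mean) simp
  also have "\<dots> = (\<integral>\<^sup>+x. ennreal c * ennreal (w x * u x) \<partial>M)"
    by (simp add: nn_integral_cmult)
  also have "\<dots> \<le> (\<integral>\<^sup>+x. ennreal (w x * u x powr p) + ennreal ((p - 1) * s powr p) * ennreal (w x) \<partial>M)"
  proof (intro nn_integral_mono)
    fix x assume x: "x \<in> space M"
    have "w x * (c * u x) \<le> w x * (u x powr p + (p - 1) * s powr p)"
      using powr_tangent_le[of p s "u x"] assms s w[OF x] u[OF x]
      by (intro mult_left_mono) (auto simp: c_def)
    then show "ennreal c * ennreal (w x * u x)
        \<le> ennreal (w x * u x powr p) + ennreal ((p - 1) * s powr p) * ennreal (w x)"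
      using c w[OF x] u[OF x] assms
      by (simp add: mult.left_commute distrib_left ennreal_leI mult.commute flip: ennreal_mult ennreal_plus)
  qed
  also have "\<dots> = ennreal P + ennreal ((p - 1) * s powr p) * (\<integral>\<^sup>+x. ennreal (w x) \<partial>M)"
    by (simp add: nn_integral_add nn_integral_cmult P)
  also have "\<dots> \<le> ennreal P + ennreal ((p - 1) * s powr p) * ennreal A"
    by (intro add_left_mono mult_left_mono mass) simp
  also have "\<dots> = ennreal (P + (p - 1) * s powr p * A)"
    using P assms by (simp add: ennreal_mult ennreal_plus)
  finally have "ennreal (c * \<tau>) \<le> ennreal (P + (p - 1) * s powr p * A)" .
  then have le: "c * \<tau> \<le> P + (p - 1) * s powr p * A"
    using P assms by (subst (asm) ennreal_le_iff) auto
  have "s powr p = s powr (p - 1) * s" using s by (simp add: powr_diff)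
  then have "c * \<tau> = p * s powr p * A" using assms by (simp add: c_def s_def)
  with le have *: "s powr p * A \<le> P" by (simp add: algebra_simps)
  have "\<tau> powr p = A powr p * s powr p" using \<tau> assms by (simp add: s_def powr_divide)
  also have "\<dots> = A powr (p - 1) * (s powr p * A)" using assms by (simp add: powr_diff)
  also have "\<dots> \<le> A powr (p - 1) * P" by (intro mult_left_mono *) simp
  finally show ?thesis using P by (simp add: ennreal_leI flip: ennreal_mult)
qed

text \<open>
  With \<open>1/r = 1 - 1/p + 1/q\<close>, the constant is \<open>D A\<^bsup>1/r\<^esup>\<close> for \<open>A = 2/\<epsilon>\<close>, which bounds \<open>\<integral> W(t) dt/t\<close>
  and hence, as \<open>W \<le> 1\<close>, also \<open>\<integral> W(t)\<^sup>r dt/t\<close>.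
\<close>

lemma Lp_norm_le_of_decay_kernel_bound:
  fixes g h :: "real \<Rightarrow> complex" and p q \<epsilon> D :: real
  assumes pq: "1 < p" "p \<le> q" and \<epsilon>: "0 < \<epsilon>" and D: "0 < D"
    and g [measurable]: "g \<in> borel_measurable (lebesgue_on {0<..})"
    and h: "\<And>y. 0 < y \<Longrightarrow> ennreal (norm (h y)) \<le>
      (\<integral>\<^sup>+x. ennreal (D * y powr (- 1 / q) * x powr (1 / p - 1) * decay_kernel \<epsilon> (x * y) * norm (g x))
        \<partial>lebesgue_on {0<..})"
  shows "Lp_norm q h \<le> ennreal (D * (2 / \<epsilon>) powr (1 - 1 / p + 1 / q)) * Lp_norm p g"
proof -
  let ?M = "lebesgue_on {0<..} :: real measure"
  interpret M: sigma_finite_measure ?M by (rule sigma_finite_lebesgue_on) simp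
  interpret MM: pair_sigma_finite ?M ?M ..
  define A where "A = 2 / \<epsilon>"
  have A: "0 < A" using \<epsilon> by (simp add: A_def)
  have q: "1 < q" "0 < q" "0 < p" using pq by auto
  have fst_m [measurable]: "(\<lambda>z. fst z) \<in> borel_measurable (?M \<Otimes>\<^sub>M ?M)"
    and snd_m [measurable]: "(\<lambda>z. snd z) \<in> borel_measurable (?M \<Otimes>\<^sub>M ?M)"
    by (rule measurable_compose[OF measurable_fst borel_measurable_ident_lebesgue_on]
             measurable_compose[OF measurable_snd borel_measurable_ident_lebesgue_on])+
  define I where "I = (\<integral>\<^sup>+x. ennreal (norm (g x) powr p) \<partial>?M)"
  show ?thesis
  proof (cases "I = \<infinity>")
    case True
    then have "Lp_norm p g = \<infinity>" by (simp add: Lp_norm_def I_def)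
    moreover have "0 < D * (2 / \<epsilon>) powr (1 - 1 / p + 1 / q)" using D \<epsilon> by simp
    ultimately show ?thesis using D \<epsilon> by (simp add: ennreal_mult_top)
  next
    case False
    then obtain N where N: "I = ennreal N" "0 \<le> N" by (cases I) auto
    (* Passage to Haar measure: up to the factor D^q, the measure \<tau>^q dy/y is |h|^q dy, and
       (x^(1/p) |g|)^p dx/x is |g|^p dx. *)
    define \<tau> where "\<tau> y = y powr (1 / q) * norm (h y) / D" for y
    define Q where "Q y = (\<integral>\<^sup>+x. ennreal (decay_kernel \<epsilon> (x * y) * norm (g x) powr p) \<partial>?M)" for y
    have \<tau>_nonneg: "0 \<le> \<tau> y" for y using D by (simp add: \<tau>_def)
    have jensen: "ennreal (\<tau> y powr p) \<le> ennreal (A powr (p - 1)) * Q y" if y: "0 < y" for y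
    proof -
      let ?H = "\<lambda>x. D * y powr (- 1 / q) * x powr (1 / p - 1)
        * decay_kernel \<epsilon> (x * y) * norm (g x)"
      have "ennreal (\<tau> y) = ennreal (y powr (1 / q) / D) * ennreal (norm (h y))"
        using D by (simp add: \<tau>_def flip: ennreal_mult)
      also have "\<dots> \<le> ennreal (y powr (1 / q) / D) * (\<integral>\<^sup>+x. ennreal (?H x) \<partial>?M)"
        by (intro mult_left_mono h y) simp
      also have "\<dots> = (\<integral>\<^sup>+x. ennreal (y powr (1 / q) / D) * ennreal (?H x) \<partial>?M)"
        by (simp add: nn_integral_cmult)
      also have "\<dots> = (\<integral>\<^sup>+x. ennreal ((decay_kernel \<epsilon> (x * y) / x) * (x powr (1 / p) * norm (g x))) \<partial>?M)"
      proof (intro nn_integral_cong)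
        fix x assume "x \<in> space ?M"
        then have x: "0 < x" by simp
        have "ennreal (y powr (1 / q) / D) * ennreal (?H x) = ennreal (y powr (1 / q) / D * (?H x))"
          using D by (intro ennreal_mult[symmetric]) (auto simp: decay_kernel_nonneg)
        also have "y powr (1 / q) / D * (?H x)
            = decay_kernel \<epsilon> (x * y) / x * (x powr (1 / p) * norm (g x))"
          using x y D by (simp add: powr_diff powr_minus)
        finally show "ennreal (y powr (1 / q) / D) * ennreal (?H x)
            = ennreal ((decay_kernel \<epsilon> (x * y) / x) * (x powr (1 / p) * norm (g x)))" .
      qed
      finally have "ennreal (\<tau> y) \<le> \<dots>" .
      then have "ennreal (\<tau> y powr p) \<le> ennreal (A powr (p - 1)) *
          (\<integral>\<^sup>+x. ennreal ((decay_kernel \<epsilon> (x * y) / x) * (x powr (1 / p) * norm (g x)) powr p) \<partial>?M)"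
        using pq A y \<epsilon> \<tau>_nonneg nn_integral_decay_kernel_le[OF \<epsilon> y]
        by (intro weighted_jensen_powr) (auto simp: A_def decay_kernel_nonneg)
      also have "(\<integral>\<^sup>+x. ennreal ((decay_kernel \<epsilon> (x * y) / x) * (x powr (1 / p) * norm (g x)) powr p) \<partial>?M) = Q y"
        unfolding Q_def using q
        by (intro nn_integral_cong) (simp add: powr_mult powr_powr)
      finally show ?thesis .
    qed
    (* The uniform bound: the kernel is at most 1. *)
    define B where "B = A powr (p - 1) * N"
    have B: "0 \<le> B" using N by (simp add: B_def)
    have Q_le: "Q y \<le> ennreal N" if "0 < y" for y
      unfolding Q_def N(1)[symmetric] I_def using that \<epsilon>
      by (intro nn_integral_mono ennreal_leI)
         (auto intro!: mult_left_le_one_le simp: decay_kernel_nonneg decay_kernel_le_1)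
    have sup: "\<tau> y powr p \<le> B" if y: "0 < y" for y
    proof -
      have "ennreal (\<tau> y powr p) \<le> ennreal (A powr (p - 1)) * ennreal N"
        by (rule order_trans[OF jensen[OF y] mult_left_mono[OF Q_le[OF y]]]) simp
      then show ?thesis using B N by (simp add: B_def flip: ennreal_mult)
    qed
    (* The L^p bound: by Tonelli, as the kernel is symmetric in x and y. *)
    have Q_int: "(\<integral>\<^sup>+y. ennreal (1 / y) * Q y \<partial>?M) \<le> ennreal (A * N)"
    proof -
      have "(\<integral>\<^sup>+y. ennreal (1 / y) * Q y \<partial>?M)
          = (\<integral>\<^sup>+y. \<integral>\<^sup>+x. ennreal (decay_kernel \<epsilon> (x * y) / y) * ennreal (norm (g x) powr p) \<partial>?M \<partial>?M)"
        unfolding Q_def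
        by (intro nn_integral_cong)
           (auto simp: decay_kernel_nonneg simp flip: nn_integral_cmult ennreal_mult)
      also have "\<dots> = (\<integral>\<^sup>+x. \<integral>\<^sup>+y. ennreal (decay_kernel \<epsilon> (x * y) / y) * ennreal (norm (g x) powr p) \<partial>?M \<partial>?M)"
        by (rule MM.Fubini') measurable
      also have "\<dots> = (\<integral>\<^sup>+x. (\<integral>\<^sup>+y. ennreal (decay_kernel \<epsilon> (y * x) / y) \<partial>?M) * ennreal (norm (g x) powr p) \<partial>?M)"
        by (intro nn_integral_cong) (simp add: nn_integral_cmult mult.commute)
      also have "\<dots> \<le> (\<integral>\<^sup>+x. ennreal A * ennreal (norm (g x) powr p) \<partial>?M)"
        using nn_integral_decay_kernel_le[OF \<epsilon>]
        by (intro nn_integral_mono mult_right_mono) (auto simp: A_def)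
      also have "\<dots> = ennreal (A * N)"
        using A N by (simp add: nn_integral_cmult I_def ennreal_mult)
      finally show ?thesis .
    qed
    define E where "E = D powr q * B powr (q / p - 1)"
    have E: "0 \<le> E" by (simp add: E_def)
    define J where "J = (\<integral>\<^sup>+y. ennreal (norm (h y) powr q) \<partial>?M)"
    have "J \<le> (\<integral>\<^sup>+y. ennreal (E * A powr (p - 1)) * (ennreal (1 / y) * Q y) \<partial>?M)"
      unfolding J_def
    proof (intro nn_integral_mono)
      fix y assume "y \<in> space ?M"
      then have y: "0 < y" by simp
      have "norm (h y) = D * y powr (- 1 / q) * \<tau> y"
        using y D by (simp add: \<tau>_def powr_minus field_simps)
      moreover have "(y powr (- 1 / q)) powr q = 1 / y"
        using powr_powr[of y "- 1 / q" q] powr_minus_divide[of y 1] y q by simp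
      ultimately have "norm (h y) powr q = D powr q * (1 / y) * \<tau> y powr q"
        using D \<tau>_nonneg[of y] by (simp add: powr_mult)
      (* Interpolation between the two bounds; here p \<le> q enters. *)
      also have "\<tau> y powr q = (\<tau> y powr p) powr (q / p - 1) * \<tau> y powr p"
        using q by (simp add: powr_powr field_simps flip: powr_add)
      also have "\<dots> \<le> B powr (q / p - 1) * \<tau> y powr p"
        using sup[OF y] pq by (intro mult_right_mono powr_mono2) auto
      finally have "norm (h y) powr q \<le> E * (1 / y) * \<tau> y powr p"
        using y D by (simp add: E_def field_simps)
      then have "ennreal (norm (h y) powr q) \<le> ennreal (E * (1 / y)) * ennreal (\<tau> y powr p)"
        using y by (simp add: E_def ennreal_leI flip: ennreal_mult)
      also have "\<dots> \<le> ennreal (E * (1 / y)) * (ennreal (A powr (p - 1)) * Q y)"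
        by (intro mult_left_mono jensen y) simp
      also have "\<dots> = ennreal (E * A powr (p - 1)) * (ennreal (1 / y) * Q y)"
      proof -
        have E_y: "ennreal (E * (1 / y)) = ennreal E * ennreal (1 / y)"
          using y E by (intro ennreal_mult) auto
        have E_A: "ennreal (E * A powr (p - 1)) = ennreal E * ennreal (A powr (p - 1))"
          using E by (intro ennreal_mult) auto
        show ?thesis unfolding E_y E_A by (simp only: mult_ac)
      qed
      finally show "ennreal (norm (h y) powr q) \<le> \<dots>" .
    qed
    also have "\<dots> = ennreal (E * A powr (p - 1)) * (\<integral>\<^sup>+y. ennreal (1 / y) * Q y \<partial>?M)"
      unfolding Q_def by (intro nn_integral_cmult) measurable
    also have "\<dots> \<le> ennreal (E * A powr (p - 1)) * ennreal (A * N)"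
      by (intro mult_left_mono Q_int) simp
    also have "\<dots> = ennreal (E * A powr (p - 1) * (A * N))"
      using A N by (simp add: E_def flip: ennreal_mult)
    also have "E * A powr (p - 1) * (A * N) = D powr q * A powr (q - q / p + 1) * N powr (q / p)"
    proof -
      have E_eq: "E = D powr q * (A powr ((p - 1) * (q / p - 1)) * N powr (q / p - 1))"
        using A N by (simp add: E_def B_def powr_mult powr_powr)
      have A_eq: "A powr ((p - 1) * (q / p - 1)) * A powr (p - 1) * A = A powr (q - q / p + 1)"
      proof -
        have "(p - 1) * (q / p - 1) + (p - 1) + 1 = q - q / p + 1"
          using q by (simp add: field_simps)
        moreover have "A powr ((p - 1) * (q / p - 1)) * A powr (p - 1) * A
            = A powr ((p - 1) * (q / p - 1) + (p - 1) + 1)"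
          using A by (simp only: powr_add powr_one)
        ultimately show ?thesis by simp
      qed
      have N_eq: "N powr (q / p - 1) * N = N powr (q / p)"
        using N by (cases "N = 0") (auto simp: powr_diff)
      have "E * A powr (p - 1) * (A * N)
          = D powr q * (A powr ((p - 1) * (q / p - 1)) * A powr (p - 1) * A) * (N powr (q / p - 1) * N)"
        by (simp only: E_eq mult_ac)
      then show ?thesis by (simp only: A_eq N_eq)
    qed
    finally have J: "J \<le> ennreal (D powr q * A powr (q - q / p + 1) * N powr (q / p))" .
    then have Jfin: "J \<noteq> \<infinity>" by (auto simp: top_unique)
    have "enn2real J powr (1 / q) \<le> (D powr q * A powr (q - q / p + 1) * N powr (q / p)) powr (1 / q)"
      using J q by (intro powr_mono2 enn2real_leI) auto
    also have "\<dots> = D * A powr (1 - 1 / p + 1 / q) * N powr (1 / p)"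
    proof -
      have "(q - q / p + 1) / q = 1 - 1 / p + 1 / q" using q by (simp add: field_simps)
      then show ?thesis using D A q N by (simp add: powr_mult powr_powr)
    qed
    finally have "ennreal (enn2real J powr (1 / q)) \<le> ennreal (D * A powr (1 - 1 / p + 1 / q)) * ennreal (N powr (1 / p))"
      using D by (simp add: ennreal_leI flip: ennreal_mult)
    then show ?thesis
      using False Jfin N by (simp add: Lp_norm_def Let_def A_def flip: I_def J_def)
  qed
qed


section \<open>The profile of the kernel and its Taylor remainder\<close>

definition profile :: "nat \<Rightarrow> (nat \<Rightarrow> complex) \<Rightarrow> real \<Rightarrow> complex" where
  "profile k a t = (\<Sum>m. a m * of_real t ^ (k * m))"

definition profile_remainder :: "nat \<Rightarrow> (nat \<Rightarrow> complex) \<Rightarrow> nat \<Rightarrow> real \<Rightarrow> complex" where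
  "profile_remainder k a j t = profile k a t - (\<Sum>m\<le>j. a m * of_real t ^ (k * m))"

lemma borel_measurable_profile [measurable]: "profile k a \<in> borel_measurable borel"
  unfolding profile_def [abs_def] by measurable

lemma borel_measurable_profile_remainder [measurable]:
  "profile_remainder k a j \<in> borel_measurable borel"
  unfolding profile_remainder_def [abs_def] by measurable

lemma norm_profile_tail_le:
  fixes a :: "nat \<Rightarrow> complex" and t :: real
  assumes a: "summable (\<lambda>m. norm (a m))" and t: "0 \<le> t" "t \<le> 1"
  shows "norm (\<Sum>m. a (m + j) * of_real t ^ (k * (m + j))) \<le> (\<Sum>m. norm (a m)) * t ^ (k * j)"
proof -
  have a': "summable (\<lambda>m. norm (a (m + j)))" using a by (rule summable_ignore_initial_segment)
  have term_le: "norm (a (m + j) * of_real t ^ (k * (m + j))) \<le> norm (a (m + j)) * t ^ (k * j)" for m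
    using t by (auto simp: norm_mult norm_power intro!: mult_left_mono power_decreasing)
  have "norm (\<Sum>m. a (m + j) * of_real t ^ (k * (m + j))) \<le> (\<Sum>m. norm (a (m + j)) * t ^ (k * j))"
    by (rule norm_suminf_le[OF term_le summable_mult2[OF a']])
  also have "\<dots> = (\<Sum>m. norm (a (m + j))) * t ^ (k * j)"
    by (rule suminf_mult2[OF a', symmetric])
  also have "(\<Sum>m. norm (a (m + j))) \<le> (\<Sum>m. norm (a m))"
    using suminf_split_initial_segment[OF a, of j] by (simp add: sum_nonneg)
  finally show ?thesis using t by (simp add: mult_right_mono)
qed

text \<open>
  On \<open>(0,1]\<close> the remainder is a tail of the series, beginning with the power \<open>k (j+1)\<close>. Beyond \<open>1\<close>
  the profile is bounded and no power in the Taylor polynomial exceeds \<open>t\<^bsup>kj\<^esup>\<close>. In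
  each range the power that occurs is the smaller of the two.
\<close>

lemma norm_profile_remainder_le:
  fixes t :: real
  assumes a: "summable (\<lambda>m. norm (a m))"
    and conv: "summable (\<lambda>m. a m * of_real t ^ (k * m))"
    and bdd: "1 < t \<Longrightarrow> norm (profile k a t) \<le> C"
    and "0 \<le> C" "0 < t"
  shows "norm (profile_remainder k a j t)
    \<le> (C + (\<Sum>m. norm (a m))) * min (t ^ (k * j)) (t ^ (k * Suc j))"
proof -
  define A where "A = (\<Sum>m. norm (a m))"
  have A: "0 \<le> A" unfolding A_def using a by (intro suminf_nonneg) auto
  show ?thesis
  proof (cases "t \<le> 1")
    case True
    have "profile_remainder k a j t = (\<Sum>m. a (m + Suc j) * of_real t ^ (k * (m + Suc j)))"
      using suminf_split_initial_segment[OF conv, of "Suc j"]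
      by (simp add: profile_remainder_def profile_def lessThan_Suc_atMost)
    also have "norm \<dots> \<le> A * t ^ (k * Suc j)"
      unfolding A_def using True \<open>0 < t\<close> by (intro norm_profile_tail_le a) auto
    also have "\<dots> \<le> (C + A) * t ^ (k * Suc j)"
      using \<open>0 \<le> C\<close> \<open>0 < t\<close> by (intro mult_right_mono) auto
    also have "t ^ (k * Suc j) = min (t ^ (k * j)) (t ^ (k * Suc j))"
      using True \<open>0 < t\<close> power_decreasing[of "k * j" "k * Suc j" t] by simp
    finally show ?thesis by (simp add: A_def)
  next
    case False
    then have t: "1 < t" by simp
    have "norm (\<Sum>m\<le>j. a m * of_real t ^ (k * m)) \<le> (\<Sum>m\<le>j. norm (a m) * t ^ (k * j))"
      using t by (intro sum_norm_le) (auto simp: norm_mult norm_power intro!: mult_left_mono power_increasing)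
    also have "\<dots> = (\<Sum>m\<le>j. norm (a m)) * t ^ (k * j)" by (simp add: sum_distrib_right)
    also have "\<dots> \<le> A * t ^ (k * j)"
      unfolding A_def using t a by (intro mult_right_mono sum_le_suminf) auto
    finally have taylor: "norm (\<Sum>m\<le>j. a m * of_real t ^ (k * m)) \<le> A * t ^ (k * j)" .
    have "C * 1 \<le> C * t ^ (k * j)"
      using t \<open>0 \<le> C\<close> by (intro mult_left_mono) auto
    then have "norm (profile_remainder k a j t) \<le> C * t ^ (k * j) + A * t ^ (k * j)"
      unfolding profile_remainder_def
      using bdd[OF t] taylor by (intro norm_triangle_le_diff) linarith
    also have "\<dots> = (C + A) * min (t ^ (k * j)) (t ^ (k * Suc j))"
      using t power_increasing[of "k * j" "k * Suc j" t] by (simp add: algebra_simps)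
    finally show ?thesis by (simp add: A_def)
  qed
qed

text \<open>
  An exponent between the orders of vanishing at zero and of growth at infinity can be factored
  out; the distance to the nearer of them is left as a rate of decay on both sides.
\<close>

lemma min_powr_le_decay_kernel:
  fixes \<alpha> \<beta> \<delta> t :: real
  assumes "0 < t" "\<alpha> \<le> \<delta>" "\<delta> \<le> \<beta>"
  shows "min (t powr \<alpha>) (t powr \<beta>) \<le> t powr \<delta> * decay_kernel (min (\<delta> - \<alpha>) (\<beta> - \<delta>)) t"
proof -
  let ?\<epsilon> = "min (\<delta> - \<alpha>) (\<beta> - \<delta>)"
  have "min (t powr \<alpha>) (t powr \<beta>) \<le> min (t powr (\<delta> + ?\<epsilon>)) (t powr (\<delta> - ?\<epsilon>))"
  proof (cases "t \<le> 1")
    case True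
    then have "t powr \<beta> \<le> t powr (\<delta> + ?\<epsilon>)" "t powr (\<delta> + ?\<epsilon>) \<le> t powr (\<delta> - ?\<epsilon>)"
      using assms by (auto intro!: powr_mono')
    then show ?thesis by simp
  next
    case False
    then have "t powr \<alpha> \<le> t powr (\<delta> - ?\<epsilon>)" "t powr (\<delta> - ?\<epsilon>) \<le> t powr (\<delta> + ?\<epsilon>)"
      using assms by (auto intro!: powr_mono)
    then show ?thesis by simp
  qed
  also have "\<dots> = t powr \<delta> * decay_kernel ?\<epsilon> t"
    using assms by (simp add: decay_kernel_def powr_add powr_diff powr_minus_divide min_mult_distrib_left)
  finally show ?thesis .
qed

section \<open>Cancellation by the moment conditions\<close>

text \<open>
  Each term of the Taylor polynomial contributes a multiple of a vanishing moment. Boundedness of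
  the profile together with the zeroth moment condition makes the integral converge absolutely,
  so that it may be split.
\<close>

lemma kernel_transform_eq_remainder_integral:
  fixes f :: "real \<Rightarrow> complex" and b0 b1 c0 c1 y C :: real
  assumes f [measurable]: "f \<in> borel_measurable (lebesgue_on {0<..})"
    and moments: "\<And>l. l \<le> j \<Longrightarrow>
      integrable (lebesgue_on {0<..}) (\<lambda>x. of_real (x powr (b0 + b1 + real (l * k))) * f x) \<and>
      (\<integral>x. of_real (x powr (b0 + b1 + real (l * k))) * f x \<partial>lebesgue_on {0<..}) = 0"
    and bdd: "\<And>t. 0 < t \<Longrightarrow> norm (profile k a t) \<le> C"
    and y: "0 < y"
  shows "kernel_transform b0 c0 (series_kernel b1 c1 k a) f y = of_real (y powr (c0 + c1)) *
      (\<integral>x. of_real (x powr (b0 + b1)) * f x * profile_remainder k a j (x * y) \<partial>lebesgue_on {0<..})"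
    and "integrable (lebesgue_on {0<..})
      (\<lambda>x. of_real (x powr (b0 + b1)) * f x * profile_remainder k a j (x * y))"
proof -
  let ?M = "lebesgue_on {0<..} :: real measure"
  define \<phi> where "\<phi> x = of_real (x powr (b0 + b1)) * f x" for x
  have \<phi>_int: "integrable ?M \<phi>" using moments[of 0] by (simp add: \<phi>_def [abs_def])
  have \<phi>_m [measurable]: "\<phi> \<in> borel_measurable ?M" using \<phi>_int by simp
  have prof_int: "integrable ?M (\<lambda>x. \<phi> x * profile k a (x * y))"
  proof (rule Bochner_Integration.integrable_bound)
    show "integrable ?M (\<lambda>x. of_real C * \<phi> x)" using \<phi>_int by simp
    have "norm (\<phi> x * profile k a (x * y)) \<le> norm (of_real C * \<phi> x)" if "0 < x" for x
    proof -
      have "norm (\<phi> x) * norm (profile k a (x * y)) \<le> norm (\<phi> x) * \<bar>C\<bar>"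
        using bdd[of "x * y"] that y by (intro mult_left_mono) auto
      then show ?thesis by (simp add: norm_mult mult.commute)
    qed
    then show "AE x in ?M. norm (\<phi> x * profile k a (x * y)) \<le> norm (of_real C * \<phi> x)"
      by (intro AE_I2) simp
  qed measurable
  have term_eq: "\<phi> x * (a m * of_real (x * y) ^ (k * m))
      = (a m * of_real (y ^ (k * m))) * (of_real (x powr (b0 + b1 + real (m * k))) * f x)"
    if "x \<in> space ?M" for x m
  proof -
    have "x powr (b0 + b1 + real (m * k)) = x powr (b0 + b1) * x ^ (k * m)"
      using that by (simp add: powr_add powr_realpow mult.commute flip: of_nat_mult)
    then show ?thesis by (simp add: \<phi>_def power_mult_distrib)
  qed
  have term_int: "integrable ?M (\<lambda>x. \<phi> x * (a m * of_real (x * y) ^ (k * m)))"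
    and term_0: "(\<integral>x. \<phi> x * (a m * of_real (x * y) ^ (k * m)) \<partial>?M) = 0" if "m \<le> j" for m
    using moments[OF that]
    by (simp_all only: Bochner_Integration.integrable_cong[OF refl term_eq]
          Bochner_Integration.integral_cong[OF refl term_eq]) simp_all
  have rem_eq: "\<phi> x * profile_remainder k a j (x * y)
      = \<phi> x * profile k a (x * y) - (\<Sum>m\<le>j. \<phi> x * (a m * of_real (x * y) ^ (k * m)))" for x
    by (simp add: profile_remainder_def right_diff_distrib sum_distrib_left)
  show "integrable ?M (\<lambda>x. of_real (x powr (b0 + b1)) * f x * profile_remainder k a j (x * y))"
    unfolding \<phi>_def[symmetric] rem_eq using prof_int term_int
    by (intro Bochner_Integration.integrable_diff Bochner_Integration.integrable_sum) auto
  have "(\<integral>x. \<phi> x * profile_remainder k a j (x * y) \<partial>?M) = (\<integral>x. \<phi> x * profile k a (x * y) \<partial>?M)"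
    unfolding rem_eq using prof_int term_int term_0
    by (subst Bochner_Integration.integral_diff)
       (auto simp: Bochner_Integration.integral_sum intro!: Bochner_Integration.integrable_sum simp del: of_real_mult)
  moreover have "(\<integral>x. of_real (x powr b0) * f x * series_kernel b1 c1 k a x y \<partial>?M)
      = (\<integral>x. of_real (y powr c1) * (\<phi> x * profile k a (x * y)) \<partial>?M)"
    by (intro Bochner_Integration.integral_cong)
       (auto simp: series_kernel_def profile_def \<phi>_def powr_add)
  ultimately show "kernel_transform b0 c0 (series_kernel b1 c1 k a) f y = of_real (y powr (c0 + c1)) *
      (\<integral>x. of_real (x powr (b0 + b1)) * f x * profile_remainder k a j (x * y) \<partial>?M)"
    using y by (simp add: kernel_transform_def powr_add \<phi>_def)
qed

section \<open>The weighted norm inequality\<close>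

theorem theorem5p1:
  fixes p q b0 b1 b2 c0 c1 c2 \<beta> \<gamma> :: real
    and k n :: nat
    and a :: "nat \<Rightarrow> complex"
  assumes "1 < p" and "p \<le> q"
    and "c1 - c2 = b1 - b2" and "b1 - b2 \<ge> 0"
    and "k \<ge> 1"
    and "summable (\<lambda>m. norm (a m))"
    and "\<forall>x>0. \<forall>y>0. summable (\<lambda>m. a m * of_real (x * y) ^ (k * m))"
    and "\<exists>c>0. \<forall>x>0. \<forall>y>0. x * y > 1 \<longrightarrow>
           norm (series_kernel b1 c1 k a x y) \<le> c * (x powr b2 * y powr c2)"
    and "n \<ge> 1"
    and "\<beta> = \<gamma> + c0 - b0 + c1 - b1 + 1 / q - 1 / conj_exp p"
    and "1 / q + c0 + c1 < \<beta>" and "\<beta> < 1 / q + c0 + c1 + real (n * k)"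
    and "\<forall>j\<in>{1..n-1}. \<beta> \<noteq> 1 / q + c0 + c1 + real (j * k)"
  shows "\<exists>C::real. C > 0 \<and>
    (\<forall>f :: real \<Rightarrow> complex.
       f \<in> borel_measurable (lebesgue_on {0<..}) \<longrightarrow>
       (\<forall>l<n.
          integrable (lebesgue_on {0<..}) (\<lambda>x. of_real (x powr (b0 + b1 + real (l * k))) * f x) \<and>
          (\<integral>x. of_real (x powr (b0 + b1 + real (l * k))) * f x \<partial>lebesgue_on {0<..}) = 0) \<longrightarrow>
       Lp_norm q (\<lambda>y. of_real (y powr (- \<beta>)) * kernel_transform b0 c0 (series_kernel b1 c1 k a) f y)
         \<le> ennreal C * Lp_norm p (\<lambda>x. of_real (x powr \<gamma>) * f x))"
proof -
  from assms(8) obtain c where c: "c > 0"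
    and K_le: "\<And>x y. x > 0 \<Longrightarrow> y > 0 \<Longrightarrow> x * y > 1 \<Longrightarrow>
      norm (series_kernel b1 c1 k a x y) \<le> c * (x powr b2 * y powr c2)"
    by blast
  have conv: "summable (\<lambda>m. a m * of_real t ^ (k * m))" if "0 < t" for t :: real
    using assms(7)[rule_format, of t 1] that by simp
  (* The profile is read off the kernel on the line y = 1. *)
  have bdd_gt: "norm (profile k a t) \<le> c" if t: "1 < t" for t
  proof -
    have "t powr b1 * norm (profile k a t) = norm (series_kernel b1 c1 k a t 1)"
      using t by (simp add: series_kernel_def profile_def norm_mult)
    also have "\<dots> \<le> c * t powr b2"
      using K_le[of t 1] t by simp
    also have "\<dots> \<le> c * t powr b1"
      using t c assms(4) by (intro mult_left_mono powr_mono) auto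
    finally show ?thesis using t by (simp add: mult.commute)
  qed
  define D where "D = c + (\<Sum>m. norm (a m))"
  have sum_nn: "0 \<le> (\<Sum>m. norm (a m))" using assms(6) by (intro suminf_nonneg) auto
  have D: "0 < D" using c sum_nn by (simp add: D_def)
  have bdd: "norm (profile k a t) \<le> D" if "0 < t" for t
  proof (cases "1 < t")
    case True
    then show ?thesis using bdd_gt[of t] sum_nn by (simp add: D_def)
  next
    case False
    then show ?thesis
      using norm_profile_tail_le[OF assms(6), of t 0 k] that c
      by (simp add: profile_def D_def)
  qed
  define \<delta> where "\<delta> = \<beta> - 1 / q - c0 - c1"
  define j where "j = nat \<lfloor>\<delta> / real k\<rfloor>"
  have k: "0 < real k" using assms(5) by simp
  have \<delta>: "0 < \<delta>" "\<delta> < real (n * k)" using assms(11,12) by (auto simp: \<delta>_def)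
  have j_eq: "real j = of_int \<lfloor>\<delta> / real k\<rfloor>"
    using \<delta> k by (simp add: j_def)
  have j_le: "real j * real k \<le> \<delta>" and lt_Suc_j: "\<delta> < (real j + 1) * real k"
    unfolding j_eq using floor_divide_lower[OF k] floor_divide_upper[OF k] by auto
  have j_n: "j < n"
  proof -
    have "real j * real k < real n * real k" using j_le \<delta> by simp
    then show ?thesis using k by simp
  qed
  have lt_j: "real (j * k) < \<delta>"
  proof (cases "j = 0")
    case False
    then have "j \<in> {1..n - 1}" using j_n by auto
    with assms(13) have "\<beta> \<noteq> 1 / q + c0 + c1 + real (j * k)" by blast
    then have "\<delta> \<noteq> real (j * k)" unfolding \<delta>_def by linarith
    then show ?thesis using j_le by simp
  qed (use \<delta> in simp)
  define \<epsilon> where "\<epsilon> = min (\<delta> - real (k * j)) (real (k * Suc j) - \<delta>)"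
  have \<epsilon>: "0 < \<epsilon>" using lt_j lt_Suc_j by (simp add: \<epsilon>_def algebra_simps)
  have rem_le: "norm (profile_remainder k a j t) \<le> D * (t powr \<delta> * decay_kernel \<epsilon> t)" if t: "0 < t" for t
  proof -
    have "norm (profile_remainder k a j t) \<le> D * min (t ^ (k * j)) (t ^ (k * Suc j))"
      unfolding D_def using t c by (intro norm_profile_remainder_le assms(6) conv bdd_gt) auto
    also have "\<dots> = D * min (t powr real (k * j)) (t powr real (k * Suc j))"
      using t by (simp only: powr_realpow)
    also have "\<dots> \<le> D * (t powr \<delta> * decay_kernel \<epsilon> t)"
      unfolding \<epsilon>_def using t D \<epsilon>
      by (intro mult_left_mono min_powr_le_decay_kernel) (auto simp: \<epsilon>_def)
    finally show ?thesis .
  qed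
  (* The homogeneity relations: every power of x and y not accounted for by the Young
     inequality is absorbed by the factor (x y)^\<delta> of the remainder bound. *)
  have exp_y: "- \<beta> + (c0 + c1) + \<delta> = - 1 / q" by (simp add: \<delta>_def)
  have exp_x: "b0 + b1 + \<delta> = 1 / p - 1 + \<gamma>"
    using assms(1,10) by (simp add: \<delta>_def conj_exp_def field_simps)
  show ?thesis
  proof (intro exI[of _ "D * (2 / \<epsilon>) powr (1 - 1 / p + 1 / q)"] conjI allI impI)
    show "0 < D * (2 / \<epsilon>) powr (1 - 1 / p + 1 / q)" using D \<epsilon> by simp
  next
    fix f :: "real \<Rightarrow> complex"
    let ?M = "lebesgue_on {0<..} :: real measure"
    assume f [measurable]: "f \<in> borel_measurable ?M"
      and moments: "\<forall>l<n. integrable ?M (\<lambda>x. of_real (x powr (b0 + b1 + real (l * k))) * f x) \<and>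
          (\<integral>x. of_real (x powr (b0 + b1 + real (l * k))) * f x \<partial>?M) = 0"
    let ?R = "\<lambda>y x. of_real (x powr (b0 + b1)) * f x * profile_remainder k a j (x * y)"
    show "Lp_norm q (\<lambda>y. of_real (y powr (- \<beta>)) * kernel_transform b0 c0 (series_kernel b1 c1 k a) f y)
         \<le> ennreal (D * (2 / \<epsilon>) powr (1 - 1 / p + 1 / q)) * Lp_norm p (\<lambda>x. of_real (x powr \<gamma>) * f x)"
    proof (rule Lp_norm_le_of_decay_kernel_bound[OF assms(1,2) \<epsilon> D])
      fix y :: real assume y: "0 < y"
      have mom: "integrable ?M (\<lambda>x. of_real (x powr (b0 + b1 + real (l * k))) * f x) \<and>
          (\<integral>x. of_real (x powr (b0 + b1 + real (l * k))) * f x \<partial>?M) = 0" if "l \<le> j" for l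
        using moments that j_n by simp
      have red_eq: "kernel_transform b0 c0 (series_kernel b1 c1 k a) f y
          = of_real (y powr (c0 + c1)) * (\<integral>x. ?R y x \<partial>?M)"
        by (rule kernel_transform_eq_remainder_integral(1)[OF f mom bdd y])
      have red_int: "integrable ?M (?R y)"
        by (rule kernel_transform_eq_remainder_integral(2)[OF f mom bdd y])
      have "ennreal (norm (of_real (y powr (- \<beta>)) * kernel_transform b0 c0 (series_kernel b1 c1 k a) f y))
          = ennreal (y powr (- \<beta> + (c0 + c1))) * ennreal (norm (\<integral>x. ?R y x \<partial>?M))"
        unfolding red_eq powr_add[of y "- \<beta>" "c0 + c1"] by (simp add: norm_mult mult.assoc flip: ennreal_mult)
      also have "\<dots> \<le> ennreal (y powr (- \<beta> + (c0 + c1))) * (\<integral>\<^sup>+x. ennreal (norm (?R y x)) \<partial>?M)"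
        by (intro mult_left_mono integral_norm_bound_ennreal red_int) simp
      also have "\<dots> = (\<integral>\<^sup>+x. ennreal (y powr (- \<beta> + (c0 + c1))) * ennreal (norm (?R y x)) \<partial>?M)"
        by (intro nn_integral_cmult[symmetric]) measurable
      also have "\<dots> \<le> (\<integral>\<^sup>+x. ennreal (D * y powr (- 1 / q) * x powr (1 / p - 1) * decay_kernel \<epsilon> (x * y)
            * norm (of_real (x powr \<gamma>) * f x)) \<partial>?M)"
      proof (intro nn_integral_mono)
        fix x assume "x \<in> space ?M"
        then have x: "0 < x" by simp
        have "y powr (- \<beta> + (c0 + c1)) * norm (?R y x)
            = y powr (- \<beta> + (c0 + c1)) * (x powr (b0 + b1) * norm (f x)) * norm (profile_remainder k a j (x * y))"
          by (simp add: norm_mult)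
        also have "\<dots> \<le> y powr (- \<beta> + (c0 + c1)) * (x powr (b0 + b1) * norm (f x))
            * (D * ((x * y) powr \<delta> * decay_kernel \<epsilon> (x * y)))"
          using x y by (intro mult_left_mono rem_le) auto
        also have "\<dots> = D * y powr (- \<beta> + (c0 + c1) + \<delta>) * x powr (b0 + b1 + \<delta>) * decay_kernel \<epsilon> (x * y) * norm (f x)"
          using x y by (simp add: powr_add powr_mult mult_ac)
        also have "\<dots> = D * y powr (- 1 / q) * x powr (1 / p - 1) * decay_kernel \<epsilon> (x * y)
            * norm (of_real (x powr \<gamma>) * f x)"
          unfolding exp_x exp_y by (simp add: powr_add norm_mult mult_ac)
        finally show "ennreal (y powr (- \<beta> + (c0 + c1))) * ennreal (norm (?R y x))
            \<le> ennreal (D * y powr (- 1 / q) * x powr (1 / p - 1) * decay_kernel \<epsilon> (x * y)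
              * norm (of_real (x powr \<gamma>) * f x))"
          by (simp only: ennreal_leI norm_ge_zero powr_ge_zero flip: ennreal_mult)
      qed
      finally show "ennreal (norm (of_real (y powr (- \<beta>)) * kernel_transform b0 c0 (series_kernel b1 c1 k a) f y))
          \<le> \<dots>" .
    qed measurable
  qed
qed

end
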